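(* Consider a sortition instance with $\mathcal P\neq\emptyset$. (1) The distribution of MaxEntropy, i.e. the uniform distribution over $\mathcal P$, satisfies higher-order equal treatment of equals: for any two pool members $i,j$ with identical feature-value vectors, it equals its image under $\tau_{i,j}$. (2) Let $\pi$ be a vector of target selection probabilities such that some $\lambda\in\Delta(\mathcal P)$ has $\pi_\lambda=\pi$, and let $\lambda^*$ be the distribution of FairMaxEntropy when optimized to optimality, i.e. the optimal solution of $$\max\ H(\lambda)\quad\text{s.t.}\quad\pi_\lambda=\pi,\ \lambda\in\Delta(\mathcal P).$$ Then $\lambda^*$ satisfies higher-order equal treatment of equals: for any two pool members $i,j$ with identical feature-value vectors and with $\pi(i)=\pi(j)$, it holds that $\lambda^*=\tau_{i,j}\lambda^*$.
   Context: Sortition instance: pool members $N=\{1,\dots,n\}$; a finite set $F$ of features, each a function $f:N\to V_f$ to a finite set; a panel size $k$; integer quotas $0\le \ell_{f,v}\le u_{f,v}\le k$ for all $f\in F$, $v\in V_f$. A panel is a set $P\subseteq N$ with $|P|=k$ and $\ell_{f,v}\le|\{i\in P: f(i)=v\}|\le u_{f,v}$ for all $f,v$; $\mathcal P$ is the set of panels and $\Delta(\mathcal P)$ the set of probability distributions on $\mathcal P$. Pool members $i,j$ have identical feature-value vectors if $f(i)=f(j)$ for all $f\in F$. For $\lambda\in\Delta(\mathcal P)$, $\pi_\lambda(i)=\sum_{P\in\mathcal P:i\in P}\lambda(P)$ and $H(\lambda)=-\sum_P\lambda(P)\log\lambda(P)$. For $i,j\in N$ and $P\subseteq N$, $\tau_{i,j}P$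 is the image of $P$ under the transposition swapping $i$ and $j$. For $i,j$ with identical feature-value vectors and $\lambda\in\Delta(\mathcal P)$, $\tau_{i,j}\lambda$ is defined by $(\tau_{i,j}\lambda)(P)=\lambda(\tau_{i,j}P)$ for all $P\in\mathcal P$. *)

theory Defs
  imports "HOL-Probability.Probability_Mass_Function" "HOL-Combinatorics.Transposition"
begin

abbreviation pool :: "nat \<Rightarrow> nat set" where
  "pool n \<equiv> {1..n}"

text \<open>
  The value sets \<open>V f\<close> of the different features are finite subsets of one type \<open>'v\<close>.
  Features are total functions, but their values outside the pool are never used.
\<close>

definition sortition_instance ::
  "nat \<Rightarrow> (nat \<Rightarrow> 'v) set \<Rightarrow> ((nat \<Rightarrow> 'v) \<Rightarrow> 'v set) \<Rightarrow> nat \<Rightarrow>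
    ((nat \<Rightarrow> 'v) \<Rightarrow> 'v \<Rightarrow> nat) \<Rightarrow> ((nat \<Rightarrow> 'v) \<Rightarrow> 'v \<Rightarrow> nat) \<Rightarrow> bool"
where
  "sortition_instance n F V k l u \<longleftrightarrow>
     finite F \<and>
     (\<forall>f\<in>F. finite (V f) \<and> f \<in> pool n \<rightarrow> V f) \<and>
     (\<forall>f\<in>F. \<forall>v\<in>V f. l f v \<le> u f v \<and> u f v \<le> k)"

definition panels ::
  "nat \<Rightarrow> (nat \<Rightarrow> 'v) set \<Rightarrow> ((nat \<Rightarrow> 'v) \<Rightarrow> 'v set) \<Rightarrow> nat \<Rightarrow>
    ((nat \<Rightarrow> 'v) \<Rightarrow> 'v \<Rightarrow> nat) \<Rightarrow> ((nat \<Rightarrow> 'v) \<Rightarrow> 'v \<Rightarrow> nat) \<Rightarrow> nat set set"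
where
  "panels n F V k l u =
     {P. P \<subseteq> pool n \<and> card P = k \<and>
         (\<forall>f\<in>F. \<forall>v\<in>V f. l f v \<le> card {i\<in>P. f i = v} \<and> card {i\<in>P. f i = v} \<le> u f v)}"

definition identical_features :: "(nat \<Rightarrow> 'v) set \<Rightarrow> nat \<Rightarrow> nat \<Rightarrow> bool" where
  "identical_features F i j \<longleftrightarrow> (\<forall>f\<in>F. f i = f j)"

definition panel_dists :: "nat set set \<Rightarrow> nat set pmf set" where
  "panel_dists PP = {lam. set_pmf lam \<subseteq> PP}"

definition selection_prob :: "nat set set \<Rightarrow> nat set pmf \<Rightarrow> nat \<Rightarrow> real" where
  "selection_prob PP lam i = (\<Sum>P | P \<in> PP \<and> i \<in> P. pmf lam P)"

text \<open>The convention \<open>0 \<cdot> log 0 = 0\<close> holds automatically, because of the factor \<open>pmf lam P\<close>.\<close>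

definition panel_entropy :: "nat set set \<Rightarrow> nat set pmf \<Rightarrow> real" where
  "panel_entropy PP lam = - (\<Sum>P\<in>PP. pmf lam P * ln (pmf lam P))"

definition swap_panel :: "nat \<Rightarrow> nat \<Rightarrow> nat set \<Rightarrow> nat set" where
  "swap_panel i j P = Transposition.transpose i j ` P"

text \<open>
  Since transpositions are involutions, the push-forward along the swap is the distribution
  that assigns to \<open>P\<close> the probability of the swapped set; see \<open>pmf_swap_dist\<close>.
\<close>

definition swap_dist :: "nat \<Rightarrow> nat \<Rightarrow> nat set pmf \<Rightarrow> nat set pmf" where
  "swap_dist i j lam = map_pmf (swap_panel i j) lam"

lemma swap_panel_swap_panel [simp]: "swap_panel i j (swap_panel i j P) = P"
  by (simp add: swap_panel_def image_comp)

lemma pmf_swap_dist: "pmf (swap_dist i j lam) P = pmf lam (swap_panel i j P)"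
proof -
  have "inj (swap_panel i j)"
    by (rule inj_on_inverseI [where g = "swap_panel i j"]) simp
  then have "pmf (map_pmf (swap_panel i j) lam) (swap_panel i j (swap_panel i j P))
      = pmf lam (swap_panel i j P)"
    by (rule pmf_map_inj')
  then show ?thesis
    by (simp add: swap_dist_def)
qed

definition fair_max_entropy_opt ::
  "nat \<Rightarrow> nat set set \<Rightarrow> (nat \<Rightarrow> real) \<Rightarrow> nat set pmf \<Rightarrow> bool" where
  "fair_max_entropy_opt n PP target lam \<longleftrightarrow>
     is_arg_max (panel_entropy PP)
       (\<lambda>mu. mu \<in> panel_dists PP \<and> (\<forall>i\<in>pool n. selection_prob PP mu i = target i)) lam"

end

theory Submission
  imports Defs "HOL-Real_Asymp.Real_Asymp"
begin

text \<open>
  Entropy is continuous on the compact polytope of feasible distributions and strictly concave,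
  so the maximiser exists and is unique. Swapping two pool members with identical features and
  equal targets maps panels to panels and therefore preserves feasibility and entropy, so the
  swapped maximiser is again a maximiser and coincides with the original one.
\<close>

section \<open>Strict midpoint convexity and continuity of \<open>x * ln x\<close> on the
  nonnegative reals\<close>

lemma xlnx_midpoint_strict:
  fixes x y :: real
  assumes "0 \<le> x" "0 \<le> y" "x \<noteq> y"
  shows "((x + y) / 2) * ln ((x + y) / 2) < (x * ln x + y * ln y) / 2"
proof -
  define m where "m = (x + y) / 2"
  have m: "m > 0" "x + y = 2 * m" and neq: "x \<noteq> m" "y \<noteq> m"
    using assms by (auto simp: m_def)
  \<comment> \<open>The left side is the tangent of \<open>t * ln t\<close> at the midpoint
    \<open>m\<close>. Strictness comes from \<open>ln s < s - 1\<close> for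
    \<open>s \<noteq> 1\<close>, with \<open>s = m / t\<close>; at \<open>t = 0\<close> the claim is
    \<open>- m < 0\<close>. In the sum over \<open>x\<close> and \<open>y\<close> the terms besides
    the logarithms cancel, because \<open>x + y = 2 * m\<close>.\<close>
  have tangent: "t * ln m + t - m < t * ln t" if "0 \<le> t" "t \<noteq> m" for t :: real
  proof (cases "t = 0")
    case False
    with that have t: "t > 0" by simp
    have "ln (m / t) < m / t - 1"
      using ln_le_minus_one[of "m / t"] ln_eq_minus_one[of "m / t"] t m that by force
    then have "t * ln (m / t) < t * (m / t - 1)"
      using t by simp
    then show ?thesis
      using t m by (simp add: ln_div algebra_simps)
  qed (use m in simp)
  have "x * ln m + y * ln m = 2 * (m * ln m)"
    by (simp add: m(2) flip: distrib_right)
  moreover have "(x * ln m + x - m) + (y * ln m + y - m) < x * ln x + y * ln y"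
    by (rule add_strict_mono[OF tangent[OF assms(1) neq(1)] tangent[OF assms(2) neq(2)]])
  ultimately have "2 * (m * ln m) < x * ln x + y * ln y"
    using m(2) by simp
  then show ?thesis
    unfolding m_def[symmetric] by simp
qed

lemma xlnx_midpoint:
  fixes x y :: real
  assumes "0 \<le> x" "0 \<le> y"
  shows "((x + y) / 2) * ln ((x + y) / 2) \<le> (x * ln x + y * ln y) / 2"
  using xlnx_midpoint_strict[OF assms] by (cases "x = y") auto

text \<open>Only the endpoint is delicate: the value of \<open>x * ln x\<close> at 0 is 0 because of
  the factor \<open>x\<close>, and this is also the limit from the right.\<close>

lemma continuous_on_xlnx: "continuous_on {0..} (\<lambda>x::real. x * ln x)"
  unfolding continuous_on_eq_continuous_within
proof
  fix x :: real
  assume "x \<in> {0..}"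
  show "continuous (at x within {0..}) (\<lambda>x. x * ln x)"
  proof (cases "x = 0")
    case True
    have "((\<lambda>x::real. x * ln x) \<longlongrightarrow> 0) (at_right 0)"
      by real_asymp
    moreover have "at (0::real) within {0..} = at_right 0"
      by (rule at_within_nhd[of _ UNIV]) auto
    ultimately show ?thesis
      using True by (simp add: continuous_within)
  next
    case False
    then show ?thesis
      by (intro continuous_intros) auto
  qed
qed

section \<open>Existence of a maximiser by compactness\<close>

text \<open>Tychonoff's theorem, restated for the topology on the function type.\<close>

lemma compact_function_box:
  fixes A :: "'a \<Rightarrow> 'b::topological_space set"
  assumes "\<And>x. compact (A x)"
  shows "compact {g. \<forall>x. g x \<in> A x}"
proof -
  have "compactin (product_topology (\<lambda>_. euclidean) UNIV) (PiE UNIV A)"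
    using assms by (simp add: compactin_PiE)
  then show ?thesis
    by (simp add: euclidean_product_topology PiE_UNIV_domain Pi_def)
qed

lemma ex_pmf_of_weights:
  assumes "finite A" "\<And>x. 0 \<le> g x" "\<And>x. x \<notin> A \<Longrightarrow> g x = 0" "(\<Sum>x\<in>A. g x) = 1"
  shows "\<exists>p. set_pmf p \<subseteq> A \<and> pmf p = g"
proof -
  have "(\<integral>\<^sup>+ x. ennreal (g x) \<partial>count_space UNIV) = (\<Sum>x\<in>A. ennreal (g x))"
    using assms by (intro nn_integral_count_space') auto
  also have "\<dots> = 1"
    using assms by (simp add: sum_ennreal)
  finally have "pmf (embed_pmf g) x = g x" for x
    using assms(2) by (intro pmf_embed_pmf) auto
  then have "pmf (embed_pmf g) = g" ..
  moreover from this have "set_pmf (embed_pmf g) \<subseteq> A"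
    using assms(3) by (metis set_pmf_iff subsetI)
  ultimately show ?thesis
    by blast
qed

text \<open>Places the simplex of distributions inside a function space, where the product topology
  is available. The factor \<open>{0}\<close> outside \<open>PP\<close> keeps every factor compact
  although the coordinates range over all sets of naturals.\<close>

lemma panel_dists_alt:
  assumes "finite PP"
  shows "pmf ` panel_dists PP =
    {g. (\<forall>P. g P \<in> (if P \<in> PP then {0..1} else {0}))} \<inter> {g. (\<Sum>P\<in>PP. g P) = 1}"
    (is "?L = ?R")
proof (intro equalityI subsetI)
  fix g assume "g \<in> ?L"
  then obtain p where p: "set_pmf p \<subseteq> PP" "g = pmf p"
    by (auto simp: panel_dists_def)
  then show "g \<in> ?R"
    using sum_pmf_eq_1[OF assms p(1)] by (auto simp: pmf_le_1 set_pmf_iff)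
next
  fix g assume "g \<in> ?R"
  then have g: "\<And>P. g P \<in> (if P \<in> PP then {0..1} else {0})" "(\<Sum>P\<in>PP. g P) = 1"
    by auto
  have "0 \<le> g P" for P
    using g(1)[of P] by (auto split: if_splits)
  moreover have "g P = 0" if "P \<notin> PP" for P
    using g(1)[of P] that by simp
  ultimately obtain p where "set_pmf p \<subseteq> PP" "pmf p = g"
    using ex_pmf_of_weights[OF assms] g(2) by blast
  then show "g \<in> ?L"
    by (auto simp: panel_dists_def)
qed

lemma ex_fair_max_entropy_opt:
  assumes fin: "finite PP"
    and feas: "lam0 \<in> panel_dists PP" "\<forall>i\<in>pool n. selection_prob PP lam0 i = target i"
  shows "\<exists>lam. fair_max_entropy_opt n PP target lam"
proof -
  define B where "B = {g :: nat set \<Rightarrow> real. \<forall>P. g P \<in> (if P \<in> PP then {0..1} else {0})}"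
  \<comment> \<open>\<open>B\<close> supplies compactness. \<open>C\<close> collects the linear
    constraints, each an equation between a finite sum of coordinates and a constant, hence
    closed.\<close>
  define C where "C = {g :: nat set \<Rightarrow> real. (\<Sum>P\<in>PP. g P) = 1} \<inter>
    (\<Inter>i\<in>pool n. {g. (\<Sum>P | P \<in> PP \<and> i \<in> P. g P) = target i})"
  have "compact B"
    unfolding B_def by (rule compact_function_box) simp
  moreover have "closed C"
    unfolding C_def
    by (intro closed_Int closed_INT ballI closed_Collect_eq continuous_on_sum
        continuous_on_product_coordinates continuous_on_const)
  ultimately have "compact (B \<inter> C)"
    by (rule compact_Int_closed)
  moreover have feasible: "pmf lam \<in> B \<inter> C \<longleftrightarrow>
      lam \<in> panel_dists PP \<and> (\<forall>i\<in>pool n. selection_prob PP lam i = target i)" for lam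
  proof -
    have "inj (pmf :: nat set pmf \<Rightarrow> _)"
      by (auto intro!: injI pmf_eqI)
    then have "lam \<in> panel_dists PP \<longleftrightarrow> pmf lam \<in> pmf ` panel_dists PP"
      by (simp add: inj_image_mem_iff)
    then show ?thesis
      unfolding panel_dists_alt[OF fin] by (auto simp: B_def C_def selection_prob_def)
  qed
  then have "B \<inter> C \<noteq> {}"
    using feas by blast
  moreover have "continuous_on (B \<inter> C) (\<lambda>g. - (\<Sum>P\<in>PP. g P * ln (g P)))"
  proof (intro continuous_on_minus continuous_on_sum)
    \<comment> \<open>On \<open>B\<close> every coordinate is nonnegative, which is where continuity
      of \<open>x * ln x\<close> is known.\<close>
    fix P
    have "0 \<le> g P" if "g \<in> B" for g
      using that unfolding B_def by (auto dest!: spec[of _ P] split: if_splits)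
    then have "(\<lambda>g. g P) ` (B \<inter> C) \<subseteq> {0..}"
      by auto
    then show "continuous_on (B \<inter> C) (\<lambda>g. g P * ln (g P))"
      by (intro continuous_on_compose2[OF continuous_on_xlnx]
          continuous_on_subset[OF continuous_on_product_coordinates]) auto
  qed
  ultimately obtain g where g: "g \<in> B \<inter> C"
    and max: "\<And>h. h \<in> B \<inter> C \<Longrightarrow>
      - (\<Sum>P\<in>PP. h P * ln (h P)) \<le> - (\<Sum>P\<in>PP. g P * ln (g P))"
    using continuous_attains_sup[of "B \<inter> C" "\<lambda>g. - (\<Sum>P\<in>PP. g P * ln (g P))"] by blast
  \<comment> \<open>The extreme value theorem yields only a function; the constraints in
    \<open>B\<close> and \<open>C\<close> make it the mass function of a distribution.\<close>
  have "g \<in> pmf ` panel_dists PP"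
    using g panel_dists_alt[OF fin] by (auto simp: B_def C_def)
  then obtain lam where lam: "pmf lam = g"
    by blast
  have "fair_max_entropy_opt n PP target lam"
    unfolding fair_max_entropy_opt_def is_arg_max_linorder feasible[symmetric]
    using g max by (auto simp: lam panel_entropy_def)
  then show ?thesis ..
qed

section \<open>Uniqueness of the maximiser by strict concavity\<close>

lemma panel_dists_midpoint:
  assumes "finite PP" "lam \<in> panel_dists PP" "mu \<in> panel_dists PP"
  obtains nu where "nu \<in> panel_dists PP" "\<And>P. pmf nu P = (pmf lam P + pmf mu P) / 2"
proof -
  have "(\<Sum>P\<in>PP. pmf lam P) = 1" "(\<Sum>P\<in>PP. pmf mu P) = 1"
    using assms by (simp_all add: panel_dists_def sum_pmf_eq_1)
  then have "(\<Sum>P\<in>PP. (pmf lam P + pmf mu P) / 2) = 1"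
    by (simp add: sum.distrib flip: sum_divide_distrib)
  moreover have "(pmf lam P + pmf mu P) / 2 = 0" if "P \<notin> PP" for P
  proof -
    have "P \<notin> set_pmf lam" "P \<notin> set_pmf mu"
      using assms that by (auto simp: panel_dists_def)
    then show ?thesis
      by (simp add: set_pmf_iff)
  qed
  ultimately obtain nu where "set_pmf nu \<subseteq> PP" "pmf nu = (\<lambda>P. (pmf lam P + pmf mu P) / 2)"
    using ex_pmf_of_weights[OF assms(1), of "\<lambda>P. (pmf lam P + pmf mu P) / 2"] by auto
  then show thesis
    by (intro that) (auto simp: panel_dists_def)
qed

text \<open>Convexity of \<open>x * ln x\<close> applies panel by panel. Distinct distributions
  differ at some \<open>P\<close>, which must lie in \<open>PP\<close> since both vanish elsewhere;
  that one summand makes the inequality strict.\<close>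

lemma panel_entropy_midpoint_strict:
  assumes fin: "finite PP" and dists: "lam \<in> panel_dists PP" "mu \<in> panel_dists PP"
    and neq: "lam \<noteq> mu" and nu: "\<And>P. pmf nu P = (pmf lam P + pmf mu P) / 2"
  shows "(panel_entropy PP lam + panel_entropy PP mu) / 2 < panel_entropy PP nu"
proof -
  obtain P where P: "pmf lam P \<noteq> pmf mu P"
    using neq by (auto intro: pmf_eqI)
  then have "P \<in> PP"
    using dists by (force simp: panel_dists_def set_pmf_iff)
  then have "(\<Sum>P\<in>PP. pmf nu P * ln (pmf nu P)) <
      (\<Sum>P\<in>PP. (pmf lam P * ln (pmf lam P) + pmf mu P * ln (pmf mu P)) / 2)"
    unfolding nu using fin P
    by (intro sum_strict_mono_ex1 bexI[of _ P] ballI xlnx_midpoint xlnx_midpoint_strict)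
      auto
  then show ?thesis
    by (simp add: panel_entropy_def sum.distrib field_simps flip: sum_divide_distrib)
qed

text \<open>Selection probabilities are linear in the distribution, so the midpoint of two distinct
  maximisers would be feasible, with entropy above the mean of theirs.\<close>

lemma fair_max_entropy_opt_unique:
  assumes fin: "finite PP"
    and lam: "fair_max_entropy_opt n PP target lam"
    and mu: "fair_max_entropy_opt n PP target mu"
  shows "lam = mu"
proof (rule ccontr)
  assume neq: "lam \<noteq> mu"
  have dists: "lam \<in> panel_dists PP" "mu \<in> panel_dists PP"
    and target: "\<forall>i\<in>pool n. selection_prob PP lam i = target i"
      "\<forall>i\<in>pool n. selection_prob PP mu i = target i"
    using lam mu by (auto simp: fair_max_entropy_opt_def is_arg_max_linorder)
  obtain nu where nu: "nu \<in> panel_dists PP" "\<And>P. pmf nu P = (pmf lam P + pmf mu P) / 2"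
    using panel_dists_midpoint[OF fin dists] by blast
  have "selection_prob PP nu i = (selection_prob PP lam i + selection_prob PP mu i) / 2" for i
    by (simp add: selection_prob_def nu sum.distrib flip: sum_divide_distrib)
  then have "\<forall>i\<in>pool n. selection_prob PP nu i = target i"
    using target by (simp del: eq_divide_eq_numeral1)
  then have "panel_entropy PP nu \<le> panel_entropy PP lam" "panel_entropy PP nu \<le> panel_entropy PP mu"
    using lam mu nu by (auto simp: fair_max_entropy_opt_def is_arg_max_linorder)
  then show False
    using panel_entropy_midpoint_strict[OF fin dists neq nu(2)] by simp
qed

section \<open>Invariance under swapping two pool members\<close>

lemma mem_swap_panel_iff: "a \<in> swap_panel i j P \<longleftrightarrow> Transposition.transpose i j a \<in> P"
  unfolding swap_panel_def by (metis image_iff transpose_involutory)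

lemma finite_panels: "finite (panels n F V k l u)"
  by (rule finite_subset[of _ "Pow (pool n)"]) (auto simp: panels_def)

text \<open>The transposition permutes the pool and leaves every feature value unchanged, so it
  preserves the panel size and all counts bounded by quotas.\<close>

lemma swap_panel_mem_panels:
  assumes "i \<in> pool n" "j \<in> pool n" "identical_features F i j" "P \<in> panels n F V k l u"
  shows "swap_panel i j P \<in> panels n F V k l u"
proof -
  have "swap_panel i j P \<subseteq> pool n"
    using assms by (auto simp: panels_def swap_panel_def Transposition.transpose_def)
  moreover have "card (swap_panel i j P) = card P"
    unfolding swap_panel_def by (simp add: card_image)
  moreover have "card {a \<in> swap_panel i j P. f a = v} = card {a \<in> P. f a = v}" if "f \<in> F" for f v
  proof -
    have "f (Transposition.transpose i j a) = f a" for a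
      using assms(3) that by (auto simp: identical_features_def Transposition.transpose_def)
    then have "{a \<in> swap_panel i j P. f a = v} = Transposition.transpose i j ` {a \<in> P. f a = v}"
      by (auto simp: swap_panel_def)
    then show ?thesis
      by (simp add: card_image)
  qed
  ultimately show ?thesis
    using assms(4) by (simp add: panels_def)
qed

text \<open>The swap is its own inverse, so closure of \<open>PP\<close> under it already makes it a
  permutation of \<open>PP\<close>.\<close>

lemma bij_betw_swap_panel:
  assumes "\<And>P. P \<in> PP \<Longrightarrow> swap_panel i j P \<in> PP"
  shows "bij_betw (swap_panel i j) PP PP"
  by (rule bij_betwI[where g = "swap_panel i j"]) (use assms in auto)

lemma swap_dist_mem_panel_dists:
  assumes "\<And>P. P \<in> PP \<Longrightarrow> swap_panel i j P \<in> PP" "lam \<in> panel_dists PP"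
  shows "swap_dist i j lam \<in> panel_dists PP"
  using assms by (auto simp: panel_dists_def swap_dist_def)

lemma panel_entropy_swap_dist:
  assumes "\<And>P. P \<in> PP \<Longrightarrow> swap_panel i j P \<in> PP"
  shows "panel_entropy PP (swap_dist i j lam) = panel_entropy PP lam"
  unfolding panel_entropy_def pmf_swap_dist
  using sum.reindex_bij_betw[OF bij_betw_swap_panel[OF assms],
      of "\<lambda>P. pmf lam P * ln (pmf lam P)"] by simp

lemma selection_prob_swap_dist:
  assumes "\<And>P. P \<in> PP \<Longrightarrow> swap_panel i j P \<in> PP"
  shows "selection_prob PP (swap_dist i j lam) a =
    selection_prob PP lam (Transposition.transpose i j a)"
  unfolding selection_prob_def pmf_swap_dist
  by (rule sum.reindex_bij_witness[where i = "swap_panel i j" and j = "swap_panel i j"])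
    (use assms in \<open>auto simp: mem_swap_panel_iff\<close>)

text \<open>The swap exchanges the selection probabilities of \<open>i\<close> and \<open>j\<close>,
  which equal targets make harmless, and it merely reorders the summands of the entropy.\<close>

lemma fair_max_entropy_opt_swap_dist:
  assumes closed: "\<And>P. P \<in> PP \<Longrightarrow> swap_panel i j P \<in> PP"
    and ij: "i \<in> pool n" "j \<in> pool n" "target i = target j"
    and opt: "fair_max_entropy_opt n PP target lam"
  shows "fair_max_entropy_opt n PP target (swap_dist i j lam)"
proof -
  have "selection_prob PP (swap_dist i j lam) a = target a" if "a \<in> pool n" for a
  proof -
    have "Transposition.transpose i j a \<in> pool n" "target (Transposition.transpose i j a) = target a"
      using that ij by (auto simp: Transposition.transpose_def)
    then show ?thesis
      using opt closed
      by (simp add: selection_prob_swap_dist fair_max_entropy_opt_def is_arg_max_linorder)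
  qed
  then show ?thesis
    using opt closed
    by (simp add: fair_max_entropy_opt_def is_arg_max_linorder swap_dist_mem_panel_dists
        panel_entropy_swap_dist)
qed

text \<open>A permutation of a finite set preserves the uniform distribution on it.\<close>

lemma swap_dist_pmf_of_set:
  assumes "finite PP" "PP \<noteq> {}" "\<And>P. P \<in> PP \<Longrightarrow> swap_panel i j P \<in> PP"
  shows "swap_dist i j (pmf_of_set PP) = pmf_of_set PP"
  unfolding swap_dist_def using bij_betw_swap_panel[OF assms(3)] assms(1,2)
  by (intro map_pmf_of_set_bij_betw) auto

theorem theorem5p3:
  fixes n k :: nat
    and F :: "(nat \<Rightarrow> 'v) set"
    and V :: "(nat \<Rightarrow> 'v) \<Rightarrow> 'v set"
    and l u :: "(nat \<Rightarrow> 'v) \<Rightarrow> 'v \<Rightarrow> nat"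
    and PP :: "nat set set"
  assumes inst: "sortition_instance n F V k l u"
    and PP: "PP = panels n F V k l u"
    and nonempty: "PP \<noteq> {}"
  shows "(\<forall>i\<in>pool n. \<forall>j\<in>pool n. identical_features F i j \<longrightarrow>
            pmf_of_set PP = swap_dist i j (pmf_of_set PP))
       \<and> (\<forall>target :: nat \<Rightarrow> real.
            (\<exists>lam\<in>panel_dists PP. \<forall>i\<in>pool n. selection_prob PP lam i = target i) \<longrightarrow>
            (\<exists>!lam. fair_max_entropy_opt n PP target lam) \<and>
            (\<forall>lam. fair_max_entropy_opt n PP target lam \<longrightarrow>
              (\<forall>i\<in>pool n. \<forall>j\<in>pool n. identical_features F i j \<and> target i = target j \<longrightarrow>
                 lam = swap_dist i j lam)))"
proof -
  have fin: "finite PP"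
    by (simp add: PP finite_panels)
  \<comment> \<open>From here on, \<open>PP\<close> enters only as a finite nonempty family closed
    under these swaps.\<close>
  have closed: "swap_panel i j P \<in> PP"
    if "i \<in> pool n" "j \<in> pool n" "identical_features F i j" "P \<in> PP" for i j P
    using swap_panel_mem_panels that unfolding PP by blast
  show ?thesis
  proof (intro conjI allI ballI impI; (elim conjE)?)
    fix i j
    assume "i \<in> pool n" "j \<in> pool n" "identical_features F i j"
    then show "pmf_of_set PP = swap_dist i j (pmf_of_set PP)"
      using swap_dist_pmf_of_set[OF fin nonempty] closed by simp
  next
    fix target :: "nat \<Rightarrow> real"
    assume "\<exists>lam\<in>panel_dists PP. \<forall>i\<in>pool n. selection_prob PP lam i = target i"
    then show "\<exists>!lam. fair_max_entropy_opt n PP target lam"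
      using ex_fair_max_entropy_opt[OF fin] fair_max_entropy_opt_unique[OF fin] by blast
  next
    fix target lam i j
    assume "fair_max_entropy_opt n PP target lam" "i \<in> pool n" "j \<in> pool n"
      "identical_features F i j" "target i = target j"
    then show "lam = swap_dist i j lam"
      using fair_max_entropy_opt_unique[OF fin] fair_max_entropy_opt_swap_dist closed by blast
  qed
qed

end
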